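(* For integers $a,b\geq 0$ with $2a+b=n-8$, $E_{\mathcal{E}}(T_{n,6}^{a,b,a+1})>E_{\mathcal{E}}(T_{n,3}^{0,n-4})$.
   Context: For a connected graph $G$, the eccentricity matrix $\mathcal{E}(G)$ is the matrix indexed by $V(G)$ with $(u,v)$-entry $d_G(u,v)$ if $d_G(u,v)=\min\{e_G(u),e_G(v)\}$ and $0$ otherwise, where $d_G$ is the distance and $e_G(u)=\max_v d_G(u,v)$ the eccentricity. The $\mathcal{E}$-energy $E_{\mathcal{E}}(G)$ is the sum of absolute values of the eigenvalues of $\mathcal{E}(G)$. $T_{n,3}^{0,n-4}$ is the tree obtained from the path $v_0v_1v_2v_3$ by attaching $n-4$ pendant vertices to $v_2$. For even $d\geq 4$ and $a,b,c\geq 0$ with $a+b+c=n-d-1$, $T_{n,d}^{a,b,c}$ is the tree obtained from the path $v_0v_1\cdots v_d$ by attaching $a$, $b$, $c$ pendant vertices to $v_{d/2-1}$, $v_{d/2}$, $v_{d/2+1}$, respectively. *)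

theory Defs
  imports
    "Graph_Theory.Shortest_Path"
    "Graph_Theory.Pair_Digraph"
    "Graph_Theory.Digraph_Component"
    "Jordan_Normal_Form.Char_Poly"
begin

(* A finite simple graph is a symmetric, loop-free pair digraph (locale pair_graph):
   each edge uv is represented by the two arcs (u,v) and (v,u).  The distance is the
   library's weighted distance for unit arc costs. *)

definition gdist :: "'a pair_pre_digraph \<Rightarrow> 'a \<Rightarrow> 'a \<Rightarrow> real" where
  "gdist G u v = real_of_ereal (wf_digraph.\<mu> (with_proj G) (\<lambda>_. 1) u v)"

lemma (in pair_wf_digraph) gdist_eqI:
  assumes "awalk u p v" "\<And>q. awalk u q v \<Longrightarrow> length p \<le> length q"
  shows "gdist G u v = real (length p)"
proof -
  have cost: "awalk_cost (\<lambda>_. 1) q = real (length q)" for q :: "('a \<times> 'a) list"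
    by (induction q) simp_all
  have "\<mu> (\<lambda>_. 1) u v = ereal (real (length p))"
    unfolding \<mu>_def cost
  proof (rule antisym)
    show "(INF q\<in>{q. awalk u q v}. ereal (real (length q))) \<le> ereal (real (length p))"
      by (rule INF_lower2[of p]) (use assms in auto)
    show "ereal (real (length p)) \<le> (INF q\<in>{q. awalk u q v}. ereal (real (length q)))"
      by (rule INF_greatest) (use assms in auto)
  qed
  then show ?thesis by (simp add: gdist_def)
qed

definition eccentricity :: "'a pair_pre_digraph \<Rightarrow> 'a \<Rightarrow> real" where
  "eccentricity G u = Max (gdist G u ` pverts G)"

(* Matrices are indexed by {0..<n}, so this is meant for graphs whose vertex set is {0..<n}. *)

definition ecc_matrix :: "nat pair_pre_digraph \<Rightarrow> real mat" where
  "ecc_matrix G = mat (card (pverts G)) (card (pverts G))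
     (\<lambda>(u, v). if gdist G u v = min (eccentricity G u) (eccentricity G v)
               then gdist G u v else 0)"

(* The eigenvalues are taken in the complex numbers and counted with algebraic multiplicity. *)

definition ecc_energy :: "nat pair_pre_digraph \<Rightarrow> real" where
  "ecc_energy G =
     (\<Sum>x\<in>#proots (char_poly (map_mat complex_of_real (ecc_matrix G))). cmod x)"

(* The path v_0 ... v_d, where v_i is the vertex i, with one further vertex d + 1 + k
   attached as a pendant vertex to the path vertex xs ! k, for every k < length xs. *)

definition path_with_pendants :: "nat \<Rightarrow> nat list \<Rightarrow> nat pair_pre_digraph" where
  "path_with_pendants d xs =
     (let E = {(i, Suc i) | i. i < d} \<union> {(xs ! k, d + 1 + k) | k. k < length xs}
      in \<lparr> pverts = {0..<d + 1 + length xs}, parcs = E \<union> E\<inverse> \<rparr>)"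

lemma pair_graph_path_with_pendants:
  assumes "set xs \<subseteq> {..d}"
  shows "pair_graph (path_with_pendants d xs)"
proof -
  have *: "xs ! k \<le> d" "xs ! k < Suc (d + length xs)" "xs ! k \<noteq> Suc (d + k)"
    "Suc (d + k) \<noteq> xs ! k" if "k < length xs" for k
    using assms nth_mem[OF that] by fastforce+
  have fin: "finite {(i, Suc i) | i. i < d}" "finite {(xs ! k, Suc (d + k)) | k. k < length xs}"
    by simp_all
  show ?thesis
    unfolding path_with_pendants_def Let_def
    by unfold_locales
      (use fin in \<open>auto simp: * symmetric_def sym_def\<close>)
qed

lemma strongly_connected_path_with_pendants:
  assumes "set xs \<subseteq> {..d}"
  shows "strongly_connected (with_proj (path_with_pendants d xs))"
proof -
  define G where "G = path_with_pendants d xs"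
  interpret pair_graph G
    unfolding G_def using assms by (rule pair_graph_path_with_pendants)
  have arcs: "i < d \<Longrightarrow> (i, Suc i) \<in> parcs G"
    "k < length xs \<Longrightarrow> (xs ! k, d + 1 + k) \<in> parcs G" for i k
    by (auto simp: G_def path_with_pendants_def Let_def)
  have verts: "pverts G = {0..<d + 1 + length xs}"
    by (simp add: G_def path_with_pendants_def Let_def)
  have path: "0 \<rightarrow>\<^sup>*\<^bsub>with_proj G\<^esub> i" if "i \<le> d" for i
    using that
  proof (induction i)
    case 0
    then show ?case by (simp add: verts)
  next
    case (Suc i)
    then have "0 \<rightarrow>\<^sup>*\<^bsub>with_proj G\<^esub> i" "(i, Suc i) \<in> parcs G" by (auto intro: arcs)
    then show ?case by (metis adj_reachable_trans reachable_adjI reachable_trans with_proj_simps(3))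
  qed
  have all: "0 \<rightarrow>\<^sup>*\<^bsub>with_proj G\<^esub> v" if v: "v \<in> pverts G" for v
  proof (cases "v \<le> d")
    case False
    define k where "k = v - (d + 1)"
    have k: "k < length xs" "v = d + 1 + k" using False v by (auto simp: k_def verts)
    then have "0 \<rightarrow>\<^sup>*\<^bsub>with_proj G\<^esub> xs ! k" using assms nth_mem[OF k(1)] by (intro path) (meson atMost_iff subsetD)
    with arcs(2)[OF k(1)] k(2) show ?thesis by (metis reachable_adjI reachable_trans with_proj_simps(3))
  qed (rule path)
  have "u \<rightarrow>\<^sup>*\<^bsub>with_proj G\<^esub> v" if "u \<in> pverts G" "v \<in> pverts G" for u v
    using symmetric_reachable'[OF all[OF that(1)]] all[OF that(2)] by (rule reachable_trans)
  then show ?thesis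
    unfolding strongly_connected_def G_def[symmetric] by (auto simp: verts)
qed

(* T_{n,3}^{0,m} with n = m + 4 *)

definition tree_diam3 :: "nat \<Rightarrow> nat pair_pre_digraph" where
  "tree_diam3 m = path_with_pendants 3 (replicate m 2)"

(* T_{n,d}^{a,b,c} with n = d + 1 + a + b + c, for even d >= 4 *)

definition tree_even :: "nat \<Rightarrow> nat \<Rightarrow> nat \<Rightarrow> nat \<Rightarrow> nat pair_pre_digraph" where
  "tree_even d a b c = path_with_pendants d
     (replicate a (d div 2 - 1) @ replicate b (d div 2) @ replicate c (d div 2 + 1))"

end

theory Submission
  imports Defs "Jordan_Normal_Form.Schur_Decomposition"
begin

text \<open>The eccentricity matrix \<open>M\<close> has trace zero, so its eigenvalues satisfy
  \<open>\<Sum>\<^bsub>i \<noteq> j\<^esub> \<lambda>\<^sub>i \<lambda>\<^sub>j = - tr (M\<^sup>2)\<close>, and the triangle inequality bounds the squared energy below by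
  \<open>2 tr (M\<^sup>2)\<close>.  For the tree of diameter 6 the entries that join an end of the path
  to the vertices whose eccentricity it realizes already give \<open>444 + 200 a + 64 b\<close>.  The tree of diameter 3 with
  \<open>L = n - 3\<close> has characteristic polynomial \<open>x\<^sup>n\<^sup>-\<^sup>4 (x\<^sup>4 - (4 + 13 L) x\<^sup>2 + 16 L)\<close>, hence squared energy
  \<open>4 (4 + 13 L + 8 \<surd>L) \<le> 4 (20 + 14 L) = 360 + 112 a + 56 b\<close>.\<close>

section \<open>Traces and power sums of eigenvalues\<close>

definition mat_trace :: "'a :: comm_ring_1 mat \<Rightarrow> 'a" where
  "mat_trace A = (\<Sum>i<dim_row A. A $$ (i, i))"

lemma mat_trace_mult:
  assumes "A \<in> carrier_mat n m" "B \<in> carrier_mat m n"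
  shows "mat_trace (A * B) = (\<Sum>i<n. \<Sum>j<m. A $$ (i, j) * B $$ (j, i))"
  using assms by (auto simp: mat_trace_def scalar_prod_def lessThan_atLeast0 intro!: sum.cong)

lemma mat_trace_mult_commute:
  assumes "A \<in> carrier_mat n m" "B \<in> carrier_mat m n"
  shows "mat_trace (A * B) = mat_trace (B * A)"
  unfolding mat_trace_mult[OF assms] mat_trace_mult[OF assms(2,1)]
  by (subst sum.swap) (simp add: mult.commute)

lemma mat_trace_similar:
  assumes "similar_mat A B"
  shows "mat_trace A = mat_trace B"
proof -
  from similar_matD[OF assms] obtain n P Q where
    carr: "{A, B, P, Q} \<subseteq> carrier_mat n n" and QP: "Q * P = 1\<^sub>m n" and A: "A = P * B * Q"
    by blast
  have "mat_trace A = mat_trace (P * (B * Q))"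
    using A carr by (metis assoc_mult_mat insert_subset)
  also have "\<dots> = mat_trace (B * Q * P)"
    using carr by (intro mat_trace_mult_commute[of _ n n]) auto
  also have "B * Q * P = B * (Q * P)"
    using carr by (intro assoc_mult_mat[of _ n n _ n _ n]) auto
  also have "\<dots> = B" using carr QP by auto
  finally show ?thesis .
qed

text \<open>For \<open>i \<noteq> j\<close> one of the entries \<open>(i, j)\<close> and
  \<open>(j, i)\<close> lies below the diagonal, so only squares of diagonal entries survive in the
  trace of \<open>B * B\<close>.\<close>

lemma mat_trace_upper_triangular:
  assumes B: "B \<in> carrier_mat n n" and ut: "upper_triangular B"
  shows "mat_trace B = sum_list (diag_mat B)"
    and "mat_trace (B * B) = (\<Sum>x\<leftarrow>diag_mat B. x\<^sup>2)"
proof -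
  show "mat_trace B = sum_list (diag_mat B)"
    by (simp add: mat_trace_def diag_mat_def sum_list_distinct_conv_sum_set atLeast0LessThan)
  have "mat_trace (B * B) = (\<Sum>i<n. \<Sum>j<n. B $$ (i, j) * B $$ (j, i))"
    by (rule mat_trace_mult[OF B B])
  also have "\<dots> = (\<Sum>i<n. \<Sum>j<n. if j = i then (B $$ (i, i))\<^sup>2 else 0)"
  proof (intro sum.cong refl)
    fix i j assume "i \<in> {..<n}" "j \<in> {..<n}"
    then show "B $$ (i, j) * B $$ (j, i) = (if j = i then (B $$ (i, i))\<^sup>2 else 0)"
      using upper_triangularD[OF ut, of i j] upper_triangularD[OF ut, of j i] B
      by (cases i j rule: linorder_cases) (auto simp: power2_eq_square)
  qed
  also have "\<dots> = (\<Sum>i<n. (B $$ (i, i))\<^sup>2)"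
    by simp
  also have "\<dots> = (\<Sum>x\<leftarrow>diag_mat B. x\<^sup>2)"
    using B by (simp add: diag_mat_def sum_list_distinct_conv_sum_set atLeast0LessThan comp_def)
  finally show "mat_trace (B * B) = (\<Sum>x\<leftarrow>diag_mat B. x\<^sup>2)" .
qed

text \<open>The characteristic polynomial splits over the complex numbers, and a Schur decomposition
  puts its roots, with multiplicity, on the diagonal of a similar triangular matrix. Trace is
  invariant under similarity, and similarity passes to squares.\<close>

lemma sum_eigenvalues:
  fixes A :: "complex mat"
  assumes A: "A \<in> carrier_mat n n"
  shows "(\<Sum>x\<in>#proots (char_poly A). x) = mat_trace A"
    and "(\<Sum>x\<in>#proots (char_poly A). x\<^sup>2) = mat_trace (A * A)"
proof -
  obtain es where es: "char_poly A = (\<Prod>a\<leftarrow>es. [:- a, 1:])"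
    using char_poly_factorized[OF A] by blast
  have roots: "proots (char_poly A) = mset es"
    unfolding es
  proof (induction es)
    case (Cons a es)
    have "(\<Prod>a\<leftarrow>es. [:- a, 1:]) \<noteq> 0" by (induction es) (auto simp del: mult_pCons_left)
    then have "proots ([:- a, 1:] * (\<Prod>a\<leftarrow>es. [:- a, 1:])) = add_mset a (mset es)"
      using Cons.IH by (subst proots_mult) auto
    then show ?case by (simp del: mult_pCons_left)
  qed simp
  obtain B P Q where "schur_decomposition A es = (B, P, Q)"
    by (cases "schur_decomposition A es") auto
  from schur_decomposition[OF A es this] have
    wit: "similar_mat_wit A B P Q" and ut: "upper_triangular B" and diag: "diag_mat B = es"
    by auto
  have B: "B \<in> carrier_mat n n" using similar_mat_witD2[OF A wit] by auto
  have pow: "M ^\<^sub>m 2 = M * M" if "M \<in> carrier_mat n n" for M :: "complex mat"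
    using that by (simp add: numeral_2_eq_2)
  have "similar_mat A B" "similar_mat (A * A) (B * B)"
    using wit similar_mat_wit_pow[OF wit, of 2] A B
    by (auto simp: similar_mat_def pow)
  then show "(\<Sum>x\<in>#proots (char_poly A). x) = mat_trace A"
    "(\<Sum>x\<in>#proots (char_poly A). x\<^sup>2) = mat_trace (A * A)"
    using mat_trace_upper_triangular[OF B ut]
    by (simp_all add: mat_trace_similar roots diag sum_mset_sum_list flip: mset_map)
qed

text \<open>Both differences are sums of products over ordered pairs of distinct positions, so this
  is the triangle inequality for those products. In the induction, a new element \<open>y\<close>
  contributes exactly \<open>2 * y * ?s\<close> on the left and \<open>2 * cmod y * ?S\<close> on
  the right.\<close>

lemma norm_sum_products_le:
  fixes M :: "complex multiset"
  shows "cmod ((\<Sum>x\<in>#M. x)\<^sup>2 - (\<Sum>x\<in>#M. x\<^sup>2))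
    \<le> (\<Sum>x\<in>#M. cmod x)\<^sup>2 - (\<Sum>x\<in>#M. (cmod x)\<^sup>2)"
proof (induction M)
  case (add y M)
  let ?s = "\<Sum>x\<in>#M. x" and ?q = "\<Sum>x\<in>#M. x\<^sup>2"
  let ?S = "\<Sum>x\<in>#M. cmod x" and ?Q = "\<Sum>x\<in>#M. (cmod x)\<^sup>2"
  have norm: "cmod ?s \<le> ?S"
    by (induction M) (auto intro: norm_triangle_le)
  have "cmod ((y + ?s)\<^sup>2 - (y\<^sup>2 + ?q)) = cmod ((?s\<^sup>2 - ?q) + 2 * y * ?s)"
    by (rule arg_cong[of _ _ cmod]) (simp add: power2_sum)
  also have "\<dots> \<le> cmod (?s\<^sup>2 - ?q) + 2 * cmod y * cmod ?s"
    using norm_triangle_ineq[of "?s\<^sup>2 - ?q" "2 * y * ?s"] by (simp only: norm_mult norm_numeral)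
  also have "\<dots> \<le> (?S\<^sup>2 - ?Q) + 2 * cmod y * ?S"
    using add.IH norm by (intro add_mono mult_left_mono) auto
  also have "\<dots> = (cmod y + ?S)\<^sup>2 - ((cmod y)\<^sup>2 + ?Q)"
    by (simp add: power2_sum)
  finally show ?case by simp
qed simp

text \<open>The factor 2 arises because \<open>cmod (\<Sum>x\<in>#M. x\<^sup>2)\<close> is bounded
  twice: by the sum of the squared moduli, and, as the sum vanishes, by the excess of the squared
  sum of moduli over it.\<close>

lemma sum_cmod_squared_ge:
  fixes M :: "complex multiset"
  assumes "(\<Sum>x\<in>#M. x) = 0"
  shows "2 * cmod (\<Sum>x\<in>#M. x\<^sup>2) \<le> (\<Sum>x\<in>#M. cmod x)\<^sup>2"
proof -
  have "cmod (\<Sum>x\<in>#M. x\<^sup>2) \<le> (\<Sum>x\<in>#M. (cmod x)\<^sup>2)"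
    by (induction M) (auto intro!: norm_triangle_le simp: norm_power)
  then show ?thesis
    using norm_sum_products_le[of M] assms by simp
qed

section \<open>Determinants of block matrices\<close>

text \<open>This is the Schur complement formula without division: right multiplication by
  \<open>?R\<close> clears the lower left block. The powers of \<open>c\<close> on both sides
  replace inverses, so that \<open>c\<close> may be a polynomial variable.\<close>

lemma det_four_block_scalar:
  fixes K :: "'a :: idom mat"
  assumes K: "K \<in> carrier_mat n n" and N: "N \<in> carrier_mat n m" and N': "N' \<in> carrier_mat m n"
  shows "det (four_block_mat K N N' (c \<cdot>\<^sub>m 1\<^sub>m m)) * c ^ n = det (c \<cdot>\<^sub>m K - N * N') * c ^ m"
proof -
  let ?A = "four_block_mat K N N' (c \<cdot>\<^sub>m 1\<^sub>m m)"
  let ?R = "four_block_mat (c \<cdot>\<^sub>m 1\<^sub>m n) (0\<^sub>m n m) (- N') (1\<^sub>m m)"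
  have "?A * ?R = four_block_mat (c \<cdot>\<^sub>m K - N * N') N (0\<^sub>m m n) (c \<cdot>\<^sub>m 1\<^sub>m m)"
  proof -
    have 1: "K * (c \<cdot>\<^sub>m 1\<^sub>m n) + N * (- N') = c \<cdot>\<^sub>m K - N * N'"
      using K N N' by (intro eq_matI) auto
    have 2: "K * 0\<^sub>m n m + N * 1\<^sub>m m = N"
      using K N by simp
    have 3: "N' * (c \<cdot>\<^sub>m 1\<^sub>m n) + c \<cdot>\<^sub>m 1\<^sub>m m * (- N') = 0\<^sub>m m n"
      using N' by (intro eq_matI) auto
    have 4: "N' * 0\<^sub>m n m + c \<cdot>\<^sub>m 1\<^sub>m m * 1\<^sub>m m = c \<cdot>\<^sub>m 1\<^sub>m m"
      using N' by simp
    show ?thesis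
      using K N N' by (subst mult_four_block_mat[of _ n n _ m _ m _ _ n _ m]) (auto simp: 1 2 3 4)
  qed
  moreover have "det (?A * ?R) = det ?A * det ?R"
    using K N N' by (intro det_mult[of _ "n + m"]) auto
  moreover have "det ?R = c ^ n"
    using N' by (subst det_four_block_mat_upper_right_zero[of _ n _ m]) auto
  moreover have "det (four_block_mat (c \<cdot>\<^sub>m K - N * N') N (0\<^sub>m m n) (c \<cdot>\<^sub>m 1\<^sub>m m))
      = det (c \<cdot>\<^sub>m K - N * N') * c ^ m"
    using K N N' by (subst det_four_block_mat_lower_left_zero[of _ n _ m]) auto
  ultimately show ?thesis by simp
qed

lemma det_3x3:
  assumes A: "(A :: 'a :: comm_ring_1 mat) \<in> carrier_mat 3 3"
  shows "det A = A $$ (0,0) * (A $$ (1,1) * A $$ (2,2) - A $$ (1,2) * A $$ (2,1))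
    - A $$ (0,1) * (A $$ (1,0) * A $$ (2,2) - A $$ (1,2) * A $$ (2,0))
    + A $$ (0,2) * (A $$ (1,0) * A $$ (2,1) - A $$ (1,1) * A $$ (2,0))"
proof -
  have two: "det B = B $$ (0,0) * B $$ (1,1) - B $$ (0,1) * B $$ (1,0)"
    if B: "B \<in> carrier_mat 2 2" for B :: "'a mat"
    using laplace_expansion_row[OF B, of 0] B
    by (simp add: cofactor_def numeral_2_eq_2 det_single mat_delete_def)
  show ?thesis
    using laplace_expansion_row[OF A, of 0] A
    by (simp add: numeral_3_eq_3 cofactor_def two mat_delete_def numeral_2_eq_2 algebra_simps)
qed

section \<open>Distances in a path with pendant vertices\<close>

text \<open>A certificate for distances to a fixed target \<open>v\<close>. Since \<open>f\<close>
  drops by at most one along each arc and is 0 at \<open>v\<close>, it bounds the length of every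
  walk to \<open>v\<close> from below; always following an arc on which it drops by one yields a
  walk attaining the bound.\<close>

lemma (in pair_wf_digraph) gdist_eq:
  assumes "u \<in> pverts G" "v \<in> pverts G"
    and refl: "f v v = 0"
    and step: "\<And>u w. (u, w) \<in> parcs G \<Longrightarrow> f u v \<le> Suc (f w v)"
    and closer: "\<And>u. u \<in> pverts G \<Longrightarrow> u \<noteq> v \<Longrightarrow> \<exists>w. (u, w) \<in> parcs G \<and> f u v = Suc (f w v)"
  shows "gdist G u v = real (f u v)"
proof -
  have lower: "f u v \<le> length q" if "awalk u q v" for u q
    using that
  proof (induction q arbitrary: u)
    case Nil
    then show ?case by (simp add: awalk_simps refl)
  next
    case (Cons e q)
    then obtain w where "(u, w) \<in> parcs G" "awalk w q v"
      by (cases e) (auto simp: awalk_simps)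
    then show ?case using Cons.IH step by fastforce
  qed
  have "\<exists>p. awalk u p v \<and> length p = f u v" if "u \<in> pverts G" for u
    using that
  proof (induction "f u v" arbitrary: u rule: less_induct)
    case (less u)
    show ?case
    proof (cases "u = v")
      case True
      then show ?thesis using less.prems refl by (intro exI[of _ "[]"]) (simp add: awalk_simps)
    next
      case False
      then obtain w where w: "(u, w) \<in> parcs G" "f u v = Suc (f w v)"
        using closer less.prems by blast
      then obtain p where "awalk w p v" "length p = f w v"
        using less.hyps[of w] in_arcsD2 by fastforce
      then show ?thesis
        using w by (intro exI[of _ "(u, w) # p"]) (simp add: awalk_simps)
    qed
  qed
  then obtain p where "awalk u p v" "length p = f u v" using assms(1) by blast
  then show ?thesis using gdist_eqI[of u p v] lower by metis
qed

text \<open>A pendant vertex is sent to the path vertex that carries it.\<close>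

definition anchor :: "nat \<Rightarrow> nat list \<Rightarrow> nat \<Rightarrow> nat" where
  "anchor d xs v = (if v \<le> d then v else xs ! (v - (d + 1)))"

text \<open>Subtraction on \<open>nat\<close> truncates, so at most one of the two differences is
  nonzero and their sum is the distance of the anchors along the path. The case \<open>u = v\<close>
  is separate because a pendant vertex would otherwise be at distance 2 from itself.\<close>

definition pendant_dist :: "nat \<Rightarrow> nat list \<Rightarrow> nat \<Rightarrow> nat \<Rightarrow> nat" where
  "pendant_dist d xs u v = (if u = v then 0 else
     (anchor d xs u - anchor d xs v) + (anchor d xs v - anchor d xs u)
       + of_bool (d < u) + of_bool (d < v))"

lemma pendant_dist_commute: "pendant_dist d xs u v = pendant_dist d xs v u"
  by (simp add: pendant_dist_def)

lemma pverts_path_with_pendants: "pverts (path_with_pendants d xs) = {0..<d + 1 + length xs}"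
  by (simp add: path_with_pendants_def Let_def)

lemma gdist_path_with_pendants:
  assumes xs: "set xs \<subseteq> {..d}" and u: "u < d + 1 + length xs" and v: "v < d + 1 + length xs"
  shows "gdist (path_with_pendants d xs) u v = real (pendant_dist d xs u v)"
proof -
  interpret pair_graph "path_with_pendants d xs"
    using xs by (rule pair_graph_path_with_pendants)
  have arcs: "(p, q) \<in> parcs (path_with_pendants d xs) \<longleftrightarrow>
      p \<le> d \<and> q \<le> d \<and> (q = Suc p \<or> p = Suc q) \<or>
      p \<le> d \<and> d < q \<and> q < d + 1 + length xs \<and> anchor d xs q = p \<or>
      q \<le> d \<and> d < p \<and> p < d + 1 + length xs \<and> anchor d xs p = q" for p q
  proof -
    have "(\<exists>k. p = xs ! k \<and> q = Suc (d + k) \<and> k < length xs) \<longleftrightarrow>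
      p \<le> d \<and> d < q \<and> q < d + 1 + length xs \<and> anchor d xs q = p" for p q
    proof
      assume "p \<le> d \<and> d < q \<and> q < d + 1 + length xs \<and> anchor d xs q = p"
      then show "\<exists>k. p = xs ! k \<and> q = Suc (d + k) \<and> k < length xs"
        by (intro exI[of _ "q - (d + 1)"]) (auto simp: anchor_def)
    next
      assume "\<exists>k. p = xs ! k \<and> q = Suc (d + k) \<and> k < length xs"
      moreover have "xs ! k \<le> d" if "k < length xs" for k
        using xs nth_mem[OF that] by auto
      ultimately show "p \<le> d \<and> d < q \<and> q < d + 1 + length xs \<and> anchor d xs q = p"
        by (auto simp: anchor_def)
    qed
    note * = this
    show ?thesis
      by (simp add: path_with_pendants_def Let_def *) auto
  qed
  have anchor_le: "anchor d xs p \<le> d" if "p < d + 1 + length xs" for p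
  proof (cases "p \<le> d")
    case False
    then have "xs ! (p - (d + 1)) \<in> set xs" using that by (intro nth_mem) linarith
    then show ?thesis using xs False by (auto simp: anchor_def)
  qed (simp add: anchor_def)
  have anchor_path: "anchor d xs p = p" if "p \<le> d" for p
    using that by (simp add: anchor_def)
  show ?thesis
  proof (rule gdist_eq)
    fix p q assume "(p, q) \<in> parcs (path_with_pendants d xs)"
    then show "pendant_dist d xs p v \<le> Suc (pendant_dist d xs q v)"
      using anchor_le[OF v] by (auto simp: arcs pendant_dist_def anchor_path)
  next
    fix p assume p: "p \<in> pverts (path_with_pendants d xs)" and "p \<noteq> v"
    consider "d < p" | "p \<le> d" "p < anchor d xs v" | "p \<le> d" "anchor d xs v < p"
      | "p \<le> d" "p = anchor d xs v" by linarith
    then show "\<exists>w. (p, w) \<in> parcs (path_with_pendants d xs)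
        \<and> pendant_dist d xs p v = Suc (pendant_dist d xs w v)"
    proof cases
      case 1
      with p \<open>p \<noteq> v\<close> anchor_le[of p] show ?thesis
        by (intro exI[of _ "anchor d xs p"])
          (auto simp: arcs pendant_dist_def anchor_path pverts_path_with_pendants)
    next
      case 2
      with \<open>p \<noteq> v\<close> anchor_le[OF v] show ?thesis
        by (intro exI[of _ "Suc p"]) (auto simp: arcs pendant_dist_def anchor_path)
    next
      case 3
      with \<open>p \<noteq> v\<close> anchor_le[OF v] show ?thesis
        by (intro exI[of _ "p - 1"]) (auto simp: arcs pendant_dist_def anchor_path)
    next
      \<comment> \<open>A path vertex is its own anchor, so here \<open>v\<close> is a pendant
        vertex at \<open>p\<close> and the last step goes to \<open>v\<close> itself.\<close>
      case 4
      with \<open>p \<noteq> v\<close> v have "d < v" by (auto simp: anchor_def split: if_splits)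
      with 4 v \<open>p \<noteq> v\<close> show ?thesis
        by (intro exI[of _ v]) (auto simp: arcs pendant_dist_def anchor_path)
    qed
  qed (use u v in \<open>auto simp: pverts_path_with_pendants pendant_dist_def\<close>)
qed

section \<open>Energy and entries of the eccentricity matrix\<close>

lemma ecc_matrix_carrier: "ecc_matrix G \<in> carrier_mat (card (pverts G)) (card (pverts G))"
  by (simp add: ecc_matrix_def)

text \<open>Symmetric distances make the matrix symmetric, so the trace of its square is the sum of
  the squared entries. Zero distances on the diagonal give trace zero, as
  \<open>sum_cmod_squared_ge\<close> requires.\<close>

lemma ecc_energy_squared_ge:
  assumes n: "n = card (pverts G)"
    and sym: "\<And>u v. u < n \<Longrightarrow> v < n \<Longrightarrow> gdist G u v = gdist G v u"
    and refl: "\<And>u. u < n \<Longrightarrow> gdist G u u = 0"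
  shows "2 * (\<Sum>u<n. \<Sum>v<n. (ecc_matrix G $$ (u, v))\<^sup>2) \<le> (ecc_energy G)\<^sup>2"
proof -
  define A where "A = map_mat complex_of_real (ecc_matrix G)"
  have A: "A \<in> carrier_mat n n"
    by (simp add: A_def ecc_matrix_def n)
  have entry: "A $$ (u, v) = complex_of_real (ecc_matrix G $$ (u, v))" if "u < n" "v < n" for u v
    using that by (simp add: A_def ecc_matrix_def n)
  have swap: "ecc_matrix G $$ (v, u) = ecc_matrix G $$ (u, v)" if "u < n" "v < n" for u v
    using that sym by (simp add: ecc_matrix_def n min.commute)
  have "mat_trace A = 0"
    using A refl by (auto simp: mat_trace_def entry intro!: sum.neutral) (simp add: ecc_matrix_def n)
  then have "2 * cmod (\<Sum>x\<in>#proots (char_poly A). x\<^sup>2) \<le> (ecc_energy G)\<^sup>2"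
    unfolding ecc_energy_def A_def[symmetric]
    using sum_eigenvalues(1)[OF A] by (intro sum_cmod_squared_ge) simp
  also have "(\<Sum>x\<in>#proots (char_poly A). x\<^sup>2)
      = complex_of_real (\<Sum>u<n. \<Sum>v<n. (ecc_matrix G $$ (u, v))\<^sup>2)"
    unfolding sum_eigenvalues[OF A] mat_trace_mult[OF A A] of_real_sum
    by (intro sum.cong refl) (auto simp: entry swap power2_eq_square)
  finally show ?thesis
    by (subst (asm) norm_of_real) (simp add: sum_nonneg)
qed

context
  fixes d n :: nat and xs :: "nat list"
  assumes xs: "set xs \<subseteq> {..d}" and n: "n = d + 1 + length xs"
begin

lemma eccentricity_path_with_pendants:
  assumes "u < n" and "\<And>v. v < n \<Longrightarrow> pendant_dist d xs u v \<le> e"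
    and "v < n" "pendant_dist d xs u v = e"
  shows "eccentricity (path_with_pendants d xs) u = real e"
  unfolding eccentricity_def pverts_path_with_pendants
proof (rule Max_eqI)
  have "gdist (path_with_pendants d xs) u v = real e"
    using gdist_path_with_pendants[OF xs, of u v] assms n by simp
  then show "real e \<in> gdist (path_with_pendants d xs) u ` {0..<d + 1 + length xs}"
    using assms(3) n by force
qed (use assms n in \<open>auto simp: gdist_path_with_pendants[OF xs]\<close>)

text \<open>If \<open>u\<close> is farthest from \<open>v\<close>, their distance is the
  eccentricity of \<open>v\<close> and at most that of \<open>u\<close>. Hence it is the minimum of
  the two, and the entry survives.\<close>

lemma ecc_matrix_path_with_pendants_farthest:
  assumes u: "u < n" and v: "v < n"
    and far: "\<And>w. w < n \<Longrightarrow> pendant_dist d xs v w \<le> pendant_dist d xs v u"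
  shows "ecc_matrix (path_with_pendants d xs) $$ (u, v) = real (pendant_dist d xs u v)"
    and "ecc_matrix (path_with_pendants d xs) $$ (v, u) = real (pendant_dist d xs u v)"
proof -
  have dist: "gdist (path_with_pendants d xs) u v = real (pendant_dist d xs u v)" "gdist (path_with_pendants d xs) v u = real (pendant_dist d xs u v)"
    using u v n by (simp_all add: gdist_path_with_pendants[OF xs] pendant_dist_commute)
  have "gdist (path_with_pendants d xs) u v \<le> eccentricity (path_with_pendants d xs) u"
    unfolding eccentricity_def pverts_path_with_pendants using v n by (intro Max_ge) auto
  moreover have "eccentricity (path_with_pendants d xs) v = real (pendant_dist d xs u v)"
    using eccentricity_path_with_pendants[OF v far u] by (simp add: pendant_dist_commute)
  ultimately show "ecc_matrix (path_with_pendants d xs) $$ (u, v) = real (pendant_dist d xs u v)"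
    "ecc_matrix (path_with_pendants d xs) $$ (v, u) = real (pendant_dist d xs u v)"
    using u v n by (simp_all add: ecc_matrix_def pverts_path_with_pendants dist)
qed

lemma ecc_energy_path_with_pendants_ge:
  "2 * (\<Sum>u<n. \<Sum>v<n. (ecc_matrix (path_with_pendants d xs) $$ (u, v))\<^sup>2) \<le> (ecc_energy (path_with_pendants d xs))\<^sup>2"
  by (rule ecc_energy_squared_ge)
    (use n in \<open>auto simp: pverts_path_with_pendants gdist_path_with_pendants[OF xs]
      pendant_dist_commute pendant_dist_def[of _ _ u u for u]\<close>)

end

section \<open>Lower bound for the tree of diameter 6\<close>

text \<open>The pieces follow the vertex numbering: \<open>k\<close> path vertices, bounded one by
  one through \<open>g\<close>, then three groups of pendant vertices with a common bound for each
  group.\<close>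

lemma sum_lessThan_ge_pieces:
  fixes f g :: "nat \<Rightarrow> real"
  assumes "\<And>i. i < k \<Longrightarrow> g i \<le> f i"
    and "\<And>i. k \<le> i \<Longrightarrow> i < k + a \<Longrightarrow> p \<le> f i"
    and "\<And>i. k + a \<le> i \<Longrightarrow> i < k + a + b \<Longrightarrow> q \<le> f i"
    and "\<And>i. k + a + b \<le> i \<Longrightarrow> i < k + a + b + c \<Longrightarrow> r \<le> f i"
  shows "(\<Sum>i<k. g i) + real a * p + real b * q + real c * r \<le> (\<Sum>i<k + a + b + c. f i)"
proof -
  have piece: "real l * t \<le> sum f {j..<j + l}" if "\<And>i. j \<le> i \<Longrightarrow> i < j + l \<Longrightarrow> t \<le> f i" for j l t
    using sum_bounded_below[of "{j..<j + l}" t f] that by simp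
  have "(\<Sum>i<k + a + b + c. f i)
      = (\<Sum>i<k. f i) + sum f {k..<k + a} + sum f {k + a..<k + a + b} + sum f {k + a + b..<k + a + b + c}"
    by (simp add: lessThan_atLeast0 sum.atLeastLessThan_concat)
  moreover have "(\<Sum>i<k. g i) \<le> (\<Sum>i<k. f i)"
    using assms(1) by (intro sum_mono) auto
  ultimately show ?thesis
    using piece[of k a p] piece[of "k + a" b q] piece[of "k + a + b" c r] assms by fastforce
qed

lemma ecc_energy_tree_even_squared_ge:
  "444 + 200 * real a + 64 * real b \<le> (ecc_energy (tree_even 6 a b (a + 1)))\<^sup>2"
proof -
  define xs where "xs = replicate a 2 @ replicate b 3 @ replicate (a + 1) (4::nat)"
  define n where "n = 7 + a + b + (a + 1)"
  define M where "M = ecc_matrix (path_with_pendants 6 xs)"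
  have xs: "set xs \<subseteq> {..6}" by (auto simp: xs_def)
  have n: "n = 6 + 1 + length xs" by (simp add: xs_def n_def)
  have anchor: "anchor 6 xs v = (if v \<le> 6 then v else if v < 7 + a then 2
      else if v < 7 + a + b then 3 else 4)" if "v < n" for v
    using that by (auto simp: anchor_def xs_def nth_append n_def nth_Cons')
  have n_gt: "7 + a + b < n" by (simp add: n_def)
  \<comment> \<open>In each use below, \<open>u\<close> is an end of the path, 0 or 6, and
    \<open>v\<close> is a vertex whose eccentricity is attained there.\<close>
  have far: "M $$ (u, v) = real k \<and> M $$ (v, u) = real k"
    if "u < n" "v < n" "pendant_dist 6 xs u v = k" "\<And>w. w < n \<Longrightarrow> pendant_dist 6 xs v w \<le> k"
    for u v k
    using ecc_matrix_path_with_pendants_farthest[OF xs n, of u v] that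
    by (simp add: M_def pendant_dist_commute[of 6 xs v u])
  have M06: "M $$ (0, 6) = real 6 \<and> M $$ (6, 0) = real 6"
    using n_gt by (intro far) (auto simp: pendant_dist_def anchor)
  have M05: "M $$ (0, 5) = real 5 \<and> M $$ (5, 0) = real 5"
    using n_gt by (intro far) (auto simp: pendant_dist_def anchor)
  have M61: "M $$ (6, 1) = real 5 \<and> M $$ (1, 6) = real 5"
    using n_gt by (intro far) (auto simp: pendant_dist_def anchor)
  have M62: "M $$ (6, i) = real 5 \<and> M $$ (i, 6) = real 5" if "7 \<le> i" "i < 7 + a" for i
    using n_gt that by (intro far) (auto simp: pendant_dist_def anchor)
  have M03: "M $$ (0, i) = real 4 \<and> M $$ (i, 0) = real 4" if "7 + a \<le> i" "i < 7 + a + b" for i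
    using n_gt that by (intro far) (auto simp: pendant_dist_def anchor)
  have M04: "M $$ (0, i) = real 5 \<and> M $$ (i, 0) = real 5" if "7 + a + b \<le> i" "i < n" for i
    using n_gt that by (intro far) (auto simp: pendant_dist_def anchor)
  have below7: "i < 7 \<longleftrightarrow> i \<in> {0, 1, 2, 3, 4, 5, 6}" for i :: nat by auto
  have sum7: "(\<Sum>i<7. g i) = g 0 + g 1 + g 2 + g 3 + g 4 + g 5 + g 6" for g :: "nat \<Rightarrow> real"
    by (simp add: eval_nat_numeral)
  define R where "R u = (\<Sum>v<n. (M $$ (u, v))\<^sup>2)" for u
  have R0: "86 + 25 * real a + 16 * real b \<le> R 0"
  proof -
    \<comment> \<open>The list bounds the squared entries of row 0 in the path columns; the values
      0, 16, 25 serve the pendant vertices at 2, 3, 4. A zero means that the entry is only estimated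
      as a nonnegative square.\<close>
    have "(\<Sum>i<7. [0, 0, 0, 0, 0, 25, 36] ! i) + real a * 0 + real b * 16 + real (a + 1) * 25 \<le> R 0"
      unfolding R_def n_def
      by (rule sum_lessThan_ge_pieces) (use M06 M05 M03 M04 in \<open>auto simp: below7 n_def\<close>)
    then show ?thesis by (simp add: sum7)
  qed
  have R6: "61 + 25 * real a \<le> R 6"
  proof -
    have "(\<Sum>i<7. [36, 25, 0, 0, 0, 0, 0] ! i) + real a * 25 + real b * 0 + real (a + 1) * 0 \<le> R 6"
      unfolding R_def n_def
      by (rule sum_lessThan_ge_pieces) (use M06 M61 M62 in \<open>auto simp: below7\<close>)
    then show ?thesis by (simp add: sum7)
  qed
  \<comment> \<open>Each row used below other than 0 and 6 is bounded by a single entry, in column 0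
    or column 6.\<close>
  have single: "(M $$ (u, v))\<^sup>2 \<le> R u" if "v < n" for u v
    unfolding R_def using that by (intro member_le_sum) auto
  have R_nonneg: "0 \<le> R u" for u
    unfolding R_def by (simp add: sum_nonneg)
  have single0: "(M $$ (u, 0))\<^sup>2 \<le> R u" and single6: "(M $$ (u, 6))\<^sup>2 \<le> R u" for u
    using n_gt by (auto intro: single)
  have R15: "25 \<le> R 1" "25 \<le> R 5"
    using single6[of 1] single0[of 5] M61 M05 by simp_all
  have R2: "25 \<le> R i" if "7 \<le> i" "i < 7 + a" for i
    using single6[of i] M62[OF that] by simp
  have R3: "16 \<le> R i" if "7 + a \<le> i" "i < 7 + a + b" for i
    using single0[of i] M03[OF that] by simp
  have R4: "25 \<le> R i" if "7 + a + b \<le> i" "i < n" for i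
    using single0[of i] M04[OF that] by simp
  have "222 + 100 * real a + 32 * real b \<le> (\<Sum>u<n. R u)"
  proof -
    \<comment> \<open>The same splitting, now applied to the row sums; rows 2, 3, 4 enter only
      through \<open>R_nonneg\<close>.\<close>
    have "(\<Sum>i<7. [86 + 25 * real a + 16 * real b, 25, 0, 0, 0, 25, 61 + 25 * real a] ! i)
        + real a * 25 + real b * 16 + real (a + 1) * 25 \<le> (\<Sum>u<n. R u)"
      unfolding n_def
      by (rule sum_lessThan_ge_pieces)
        (use R0 R6 R15 R2 R3 R4 R_nonneg in \<open>auto simp: below7 n_def\<close>)
    then show ?thesis by (simp add: sum7)
  qed
  moreover have "2 * (\<Sum>u<n. R u) \<le> (ecc_energy (path_with_pendants 6 xs))\<^sup>2"
    unfolding R_def M_def by (rule ecc_energy_path_with_pendants_ge[OF xs n])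
  ultimately show ?thesis
    by (simp add: tree_even_def xs_def)
qed

section \<open>Exact energy of the tree of diameter 3\<close>

text \<open>The path end 3 is a leaf at 2 just like the added pendant vertices, so all vertices from
  3 on behave alike. They have eccentricity 3 but mutual distance at most 2, hence no nonzero
  entries among themselves.\<close>

lemma ecc_matrix_tree_diam3:
  assumes u: "u < m + 4" and v: "v < m + 4"
  shows "ecc_matrix (tree_diam3 m) $$ (u, v) =
    (if (u, v) \<in> {(0, 2), (2, 0)} then 2
     else if u = 0 \<and> 3 \<le> v \<or> v = 0 \<and> 3 \<le> u then 3
     else if u = 1 \<and> 3 \<le> v \<or> v = 1 \<and> 3 \<le> u then 2 else 0)"
proof -
  let ?xs = "replicate m (2::nat)"
  have xs: "set ?xs \<subseteq> {..3}" by auto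
  have n: "m + 4 = 3 + 1 + length ?xs" by simp
  have anchor: "anchor 3 ?xs w = (if w \<le> 3 then w else 2)" if "w < m + 4" for w
    using that by (auto simp: anchor_def)
  note ecc = eccentricity_path_with_pendants[OF xs n, folded tree_diam3_def]
  have e0: "eccentricity (tree_diam3 m) 0 = real 3"
    by (rule ecc[where v = 3]) (auto simp: pendant_dist_def anchor)
  have e1: "eccentricity (tree_diam3 m) 1 = real 2"
    by (rule ecc[where v = 3]) (auto simp: pendant_dist_def anchor)
  have e2: "eccentricity (tree_diam3 m) 2 = real 2"
    by (rule ecc[where v = 0]) (auto simp: pendant_dist_def anchor)
  have e3: "eccentricity (tree_diam3 m) w = real 3" if "3 \<le> w" "w < m + 4" for w
    using that by (intro ecc[where v = 0]) (auto simp: pendant_dist_def anchor)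
  have cases: "w = 0 \<or> w = 1 \<or> w = 2 \<or> 3 \<le> w" for w :: nat by auto
  have "gdist (tree_diam3 m) u v = real (pendant_dist 3 ?xs u v)"
    using gdist_path_with_pendants[OF xs, of u v] u v by (simp add: tree_diam3_def)
  then have "ecc_matrix (tree_diam3 m) $$ (u, v) =
     (if real (pendant_dist 3 ?xs u v)
        = min (eccentricity (tree_diam3 m) u) (eccentricity (tree_diam3 m) v)
      then real (pendant_dist 3 ?xs u v) else 0)"
    using u v by (simp add: ecc_matrix_def tree_diam3_def pverts_path_with_pendants)
  then show ?thesis
    using cases[of u] cases[of v] u v
    by (elim disjE) (simp_all add: e0 e1 e2 e3 pendant_dist_def anchor del: One_nat_def)
qed

text \<open>The \<open>m + 1\<close> leaves at vertex 2 form a scalar block of the characteristic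
  matrix, so \<open>det_four_block_scalar\<close> reduces the determinant to size 3.\<close>

lemma char_poly_tree_diam3:
  "char_poly (map_mat complex_of_real (ecc_matrix (tree_diam3 m)))
    = monom 1 m * [:16 * of_nat (m + 1), 0, - (4 + 13 * of_nat (m + 1)), 0, 1:]"
proof -
  let ?A = "map_mat complex_of_real (ecc_matrix (tree_diam3 m))"
  define L where "L = m + 1"
  define x :: "complex poly" where "x = [:0, 1:]"
  \<comment> \<open>Off the diagonal, \<open>i + j = 2\<close> holds exactly for the positions
    \<open>(0, 2)\<close> and \<open>(2, 0)\<close>.\<close>
  define K where "K = mat 3 3 (\<lambda>(i, j). if i = j then x else if i + j = 2 then - 2 else 0)"
  define N where "N = mat 3 L (\<lambda>(i, j::nat). [- 3, - 2, 0::complex poly] ! i)"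
  define N' where "N' = mat L 3 (\<lambda>(i::nat, j). [- 3, - 2, 0::complex poly] ! j)"
  define Q where "Q = [:16 * of_nat L, 0, - (4 + 13 * of_nat L), 0, 1 :: complex:]"
  have carr: "K \<in> carrier_mat 3 3" "N \<in> carrier_mat 3 L" "N' \<in> carrier_mat L 3"
    by (simp_all add: K_def N_def N'_def)
  have M: "ecc_matrix (tree_diam3 m) \<in> carrier_mat (m + 4) (m + 4)"
    using ecc_matrix_carrier[of "tree_diam3 m"]
    by (simp add: tree_diam3_def pverts_path_with_pendants add.commute)
  have below3: "i < 3 \<longleftrightarrow> i \<in> {0, 1, 2}" for i :: nat by auto
  have "char_poly_matrix ?A = four_block_mat K N N' (x \<cdot>\<^sub>m 1\<^sub>m L)"
  proof (rule eq_matI)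
    fix i j assume "i < dim_row (four_block_mat K N N' (x \<cdot>\<^sub>m 1\<^sub>m L))"
      and "j < dim_col (four_block_mat K N N' (x \<cdot>\<^sub>m 1\<^sub>m L))"
    then have ij: "i < m + 4" "j < m + 4"
      by (simp_all add: K_def L_def)
    have entry: "char_poly_matrix ?A $$ (i, j)
        = (if i = j then x else 0) + [: - complex_of_real (ecc_matrix (tree_diam3 m) $$ (i, j)) :]"
      using ij M by (simp add: char_poly_matrix_def x_def)
    have cases: "k = 0 \<or> k = 1 \<or> k = 2 \<or> 3 \<le> k" for k :: nat by auto
    show "char_poly_matrix ?A $$ (i, j) = four_block_mat K N N' (x \<cdot>\<^sub>m 1\<^sub>m L) $$ (i, j)"
      using cases[of i] cases[of j] ij unfolding entry ecc_matrix_tree_diam3[OF ij]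
      by (elim disjE) (simp_all add: K_def N_def N'_def L_def numeral_poly eq_diff_iff del: One_nat_def)
  qed (use M in \<open>simp_all add: char_poly_matrix_def K_def L_def\<close>)
  then have "char_poly ?A * x ^ 3 = det (x \<cdot>\<^sub>m K - N * N') * x ^ L"
    by (simp add: char_poly_def det_four_block_scalar[OF carr])
  also have "det (x \<cdot>\<^sub>m K - N * N') = x ^ 2 * Q"
  proof -
    let ?D = "x \<cdot>\<^sub>m K - N * N'"
    \<comment> \<open>All \<open>L\<close> columns of \<open>N\<close> are equal, so
      \<open>N * N'\<close> is \<open>L\<close> times a matrix of rank one.\<close>
    have entry: "?D $$ (i, j) = x * K $$ (i, j) - of_nat L * ([- 3, - 2, 0] ! i * [- 3, - 2, 0] ! j)"
      if "i < 3" "j < 3" for i j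
      using that carr by (simp add: scalar_prod_def N_def N'_def)
    have K: "K $$ (0, 0) = x" "K $$ (0, 1) = 0" "K $$ (0, 2) = - 2"
      "K $$ (1, 0) = 0" "K $$ (1, 1) = x" "K $$ (1, 2) = 0"
      "K $$ (2, 0) = - 2" "K $$ (2, 1) = 0" "K $$ (2, 2) = x"
      by (simp_all add: K_def)
    have "?D $$ (0, 0) = x ^ 2 - 9 * of_nat L" "?D $$ (0, 1) = - 6 * of_nat L" "?D $$ (0, 2) = - 2 * x"
      "?D $$ (1, 0) = - 6 * of_nat L" "?D $$ (1, 1) = x ^ 2 - 4 * of_nat L" "?D $$ (1, 2) = 0"
      "?D $$ (2, 0) = - 2 * x" "?D $$ (2, 1) = 0" "?D $$ (2, 2) = x ^ 2"
      by (simp_all add: entry K power2_eq_square del: One_nat_def)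
    note D = this
    have D_carrier: "?D \<in> carrier_mat 3 3" using carr by auto
    have "det ?D = x ^ 2 * (x ^ 4 - (4 + 13 * of_nat L) * x ^ 2 + 16 * of_nat L)"
      unfolding det_3x3[OF D_carrier] D
      by (simp add: power4_eq_xxxx power2_eq_square algebra_simps)
    moreover have "Q = x ^ 4 - (4 + 13 * of_nat L) * x ^ 2 + 16 * of_nat L"
      by (simp add: Q_def x_def power4_eq_xxxx power2_eq_square numeral_poly of_nat_poly)
    ultimately show ?thesis by simp
  qed
  also have "x ^ 2 * Q * x ^ L = x ^ (L + 2) * Q"
    by (simp add: power_add power2_eq_square mult_ac)
  \<comment> \<open>As \<open>L + 2 = m + 3\<close>, the surplus factor \<open>x ^ 3\<close> from
    the block formula can be cancelled.\<close>
  also have "\<dots> = x ^ m * Q * x ^ 3"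
    by (simp add: L_def power_add mult_ac power2_eq_square power3_eq_cube)
  finally have "char_poly ?A * x ^ 3 = x ^ m * Q * x ^ 3" .
  moreover have "x ^ 3 \<noteq> 0" by (simp add: x_def)
  ultimately have "char_poly ?A = x ^ m * Q" by (simp only: mult_cancel_right) simp
  then show ?thesis
    by (simp add: Q_def L_def x_def monom_altdef)
qed

text \<open>The positive roots \<open>s\<close>, \<open>t\<close> of the quartic factor satisfy \<open>s\<^sup>2 + t\<^sup>2 = 4 + 13 L\<close> and
  \<open>s t = 4 \<surd>L\<close>, whence their sum.\<close>

lemma ecc_energy_tree_diam3:
  "ecc_energy (tree_diam3 m) = 2 * sqrt (4 + 13 * real (m + 1) + 8 * sqrt (real (m + 1)))"
proof -
  define L where "L = real (m + 1)"
  \<comment> \<open>These are the prospective values of \<open>s + t\<close> and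
    \<open>s - t\<close>, since the squares of the latter must be \<open>4 + 13 * L\<close> plus or
    minus \<open>8 * sqrt L\<close>.\<close>
  define p where "p = sqrt (4 + 13 * L + 8 * sqrt L)"
  define q where "q = sqrt (4 + 13 * L - 8 * sqrt L)"
  define s where "s = (p + q) / 2"
  define t where "t = (p - q) / 2"
  have L: "0 \<le> L" "1 \<le> L" by (simp_all add: L_def)
  \<comment> \<open>This makes the radicand of \<open>q\<close> nonnegative, so that both roots are
    real.\<close>
  have "sqrt L \<le> L" using L by (simp add: real_le_lsqrt self_le_power)
  then have nonneg: "0 \<le> 4 + 13 * L - 8 * sqrt L" using L by linarith
  have p2: "p\<^sup>2 = 4 + 13 * L + 8 * sqrt L" and q2: "q\<^sup>2 = 4 + 13 * L - 8 * sqrt L"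
    using nonneg L by (simp_all add: p_def q_def)
  have st: "0 \<le> s" "0 \<le> t"
    using L nonneg by (simp_all add: s_def t_def p_def q_def)
  have sum: "s\<^sup>2 + t\<^sup>2 = 4 + 13 * L"
    using p2 q2 by (simp add: s_def t_def power2_eq_square field_simps)
  have "s * t = 4 * sqrt L"
    using p2 q2 by (simp add: s_def t_def power2_eq_square field_simps)
  then have "(s * t)\<^sup>2 = (4 * sqrt L)\<^sup>2" by simp
  then have prod: "s\<^sup>2 * t\<^sup>2 = 16 * L"
    using L by (simp add: power_mult_distrib)
  have factor: "[:16 * of_nat (m + 1), 0, - (4 + 13 * of_nat (m + 1)), 0, 1:]
    = [:complex_of_real s, 1:] * [:- complex_of_real s, 1:]
      * ([:complex_of_real t, 1:] * [:- complex_of_real t, 1:])"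
  proof -
    have "16 * of_nat (m + 1) = complex_of_real (s\<^sup>2 * t\<^sup>2)"
      "4 + 13 * of_nat (m + 1) = complex_of_real (s\<^sup>2 + t\<^sup>2)"
      unfolding prod sum by (simp_all add: L_def)
    note eqs = this
    show ?thesis
      unfolding eqs of_real_add of_real_mult by (simp add: power2_eq_square algebra_simps)
  qed
  have nz: "[:complex_of_real s, 1:] * [:- complex_of_real s, 1:] \<noteq> 0"
    "[:complex_of_real t, 1:] * [:- complex_of_real t, 1:] \<noteq> 0"
    "monom (1::complex) m \<noteq> 0"
    by (simp_all del: mult_pCons_left mult_pCons_right)
  have "proots (monom (1::complex) m) = replicate_mset m 0"
    using proots_power[of "[:0::complex, 1:]" m] by (simp add: monom_altdef repeat_mset_replicate_mset)
  \<comment> \<open>The roots are 0 with multiplicity \<open>m\<close> together with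
    \<open>s\<close>, \<open>- s\<close>, \<open>t\<close> and \<open>- t\<close>.\<close>
  then have "ecc_energy (tree_diam3 m) = 2 * (s + t)"
    unfolding ecc_energy_def char_poly_tree_diam3 factor
    using st nz by (simp add: proots_mult del: mult_pCons_left mult_pCons_right)
  moreover have "s + t = p" by (simp add: s_def t_def field_simps)
  ultimately show ?thesis by (simp add: p_def L_def)
qed

section \<open>Comparison of the squared energies\<close>

theorem theorem4p4:
  fixes a b n :: nat
  assumes "int (2 * a + b) = int n - 8"
  shows "ecc_energy (tree_even 6 a b (a + 1)) > ecc_energy (tree_diam3 (n - 4))"
proof -
  define L where "L = real (n - 4 + 1)"
  \<comment> \<open>The hypothesis, stated over the integers, forces \<open>n \<ge> 8\<close>, so
    the subtraction \<open>n - 4\<close> on \<open>nat\<close> does not truncate.\<close>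
  have L: "L = 5 + 2 * real a + real b"
    using assms by (simp add: L_def)
  \<comment> \<open>The constant 4 makes the mixed term of the square exactly
    \<open>8 * sqrt L\<close>, which is thereby replaced by a linear bound in
    \<open>L\<close>.\<close>
  have "0 \<le> (sqrt L - 4)\<^sup>2" by simp
  then have "8 * sqrt L \<le> L + 16"
    using L by (simp add: power2_diff)
  moreover have "(ecc_energy (tree_diam3 (n - 4)))\<^sup>2 = 4 * (4 + 13 * L + 8 * sqrt L)"
    unfolding ecc_energy_tree_diam3 L_def[symmetric] using L by (simp add: power_mult_distrib)
  ultimately have "(ecc_energy (tree_diam3 (n - 4)))\<^sup>2 \<le> 4 * (20 + 14 * L)"
    by simp
  also have "\<dots> < 444 + 200 * real a + 64 * real b"
    using L by simp
  also have "\<dots> \<le> (ecc_energy (tree_even 6 a b (a + 1)))\<^sup>2"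
    by (rule ecc_energy_tree_even_squared_ge)
  finally have "(ecc_energy (tree_diam3 (n - 4)))\<^sup>2 < (ecc_energy (tree_even 6 a b (a + 1)))\<^sup>2" .
  moreover have "0 \<le> (\<Sum>x\<in>#A. cmod x)" for A
    by (induction A) auto
  then have "0 \<le> ecc_energy (tree_even 6 a b (a + 1))"
    unfolding ecc_energy_def .
  ultimately show ?thesis
    by (rule power2_less_imp_less)
qed

end
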